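(* Let $R$ be a reduced commutative ring with identity, with total quotient ring $T(R)$, and let $\mathcal{M}$ be the space of minimal prime ideals of $R$. The following conditions are equivalent: (i) $T(R)$ is a von Neumann regular ring. (ii) $R$ satisfies property $(A)$ and $\mathcal{M}$ is compact. (iii) $R$ has no $sd$-ideal. (iv) $R$ satisfies property $(a.c.)$ and $\mathcal{M}$ is compact.
   Context: $\mathcal{M}$ is the set of minimal prime ideals of $R$ with the Zariski topology, whose base of open sets is $\{D(a): a\in R\}$, where $D(a)=\{P\in\mathcal{M}: a\notin P\}$. $\mathcal{Z}(R)$ is the set of zero divisors of $R$; for $S\subseteq R$, $\mathrm{ann}(S)=\{a\in R: aS=0\}$. $R$ has property $(A)$ if $\mathrm{ann}(I)\neq 0$ for every finitely generated ideal $I\subseteq\mathcal{Z}(R)$. $R$ has property $(a.c.)$ if for every finitely generated ideal $I$ of $R$ there is $c\in R$ with $\mathrm{ann}(I)=\mathrm{ann}(c)$. An ideal $I$ is an $sd$-ideal (strongly dense ideal) if $I\subseteq\mathcal{Z}(R)$ and $I$ is contained in no minimal prime ideal of $R$. *)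

theory Defs
  imports "HOL-Algebra.Ideal" "HOL-Analysis.Abstract_Topology"
begin

section \<open>Zero divisors, annihilators, reduced rings\<close>

text \<open>With this convention \<open>\<zero>\<close> is a zero divisor of every nonzero ring, as it must be
  for an ideal to be able to consist of zero divisors.\<close>

definition zero_divisors :: "('a, 'm) ring_scheme \<Rightarrow> 'a set" where
  "zero_divisors R =
    {a \<in> carrier R. \<exists>b \<in> carrier R. b \<noteq> \<zero>\<^bsub>R\<^esub> \<and> a \<otimes>\<^bsub>R\<^esub> b = \<zero>\<^bsub>R\<^esub>}"

definition regular_elements :: "('a, 'm) ring_scheme \<Rightarrow> 'a set" where
  "regular_elements R = carrier R - zero_divisors R"

definition ann :: "('a, 'm) ring_scheme \<Rightarrow> 'a set \<Rightarrow> 'a set" where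
  "ann R S = {a \<in> carrier R. \<forall>s \<in> S. a \<otimes>\<^bsub>R\<^esub> s = \<zero>\<^bsub>R\<^esub>}"

definition reduced_ring :: "('a, 'm) ring_scheme \<Rightarrow> bool" where
  "reduced_ring R \<longleftrightarrow> ring R \<and>
    (\<forall>a \<in> carrier R. \<forall>n::nat. a [^]\<^bsub>R\<^esub> n = \<zero>\<^bsub>R\<^esub> \<longrightarrow> a = \<zero>\<^bsub>R\<^esub>)"

definition von_neumann_regular :: "('a, 'm) ring_scheme \<Rightarrow> bool" where
  "von_neumann_regular R \<longleftrightarrow> ring R \<and>
    (\<forall>a \<in> carrier R. \<exists>x \<in> carrier R. a = a \<otimes>\<^bsub>R\<^esub> x \<otimes>\<^bsub>R\<^esub> a)"

section \<open>The total quotient ring\<close>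

text \<open>Fractions \<open>a/s\<close> with \<open>s\<close> regular, as classes of pairs \<open>(a, s)\<close>. Since denominators are
  cancellable, no auxiliary multiplier is needed in the equivalence relation.\<close>

definition frac_rel :: "('a, 'm) ring_scheme \<Rightarrow> (('a \<times> 'a) \<times> ('a \<times> 'a)) set" where
  "frac_rel R = {((a, s), (b, t)).
     a \<in> carrier R \<and> s \<in> regular_elements R \<and> b \<in> carrier R \<and> t \<in> regular_elements R \<and>
     a \<otimes>\<^bsub>R\<^esub> t = b \<otimes>\<^bsub>R\<^esub> s}"

definition fraction :: "('a, 'm) ring_scheme \<Rightarrow> 'a \<Rightarrow> 'a \<Rightarrow> ('a \<times> 'a) set" where
  "fraction R a s = frac_rel R `` {(a, s)}"

definition total_quotient_ring :: "('a, 'm) ring_scheme \<Rightarrow> ('a \<times> 'a) set ring" where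
  "total_quotient_ring R =
    \<lparr>carrier = (carrier R \<times> regular_elements R) // frac_rel R,
     mult = (\<lambda>X Y. \<Union>(a, s) \<in> X. \<Union>(b, t) \<in> Y. fraction R (a \<otimes>\<^bsub>R\<^esub> b) (s \<otimes>\<^bsub>R\<^esub> t)),
     one = fraction R \<one>\<^bsub>R\<^esub> \<one>\<^bsub>R\<^esub>,
     zero = fraction R \<zero>\<^bsub>R\<^esub> \<one>\<^bsub>R\<^esub>,
     add = (\<lambda>X Y. \<Union>(a, s) \<in> X. \<Union>(b, t) \<in> Y.
              fraction R (a \<otimes>\<^bsub>R\<^esub> t \<oplus>\<^bsub>R\<^esub> b \<otimes>\<^bsub>R\<^esub> s) (s \<otimes>\<^bsub>R\<^esub> t))\<rparr>"

text \<open>The unions above run over all representatives; they are well defined, and the result is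
  a commutative ring.\<close>

context cring
begin

lemma regular_carrier: "s \<in> regular_elements R \<Longrightarrow> s \<in> carrier R"
  by (simp add: regular_elements_def)

lemma regular_zeroD:
  "\<lbrakk>s \<in> regular_elements R; a \<in> carrier R; a \<otimes> s = \<zero>\<rbrakk> \<Longrightarrow> a = \<zero>"
  by (auto simp: regular_elements_def zero_divisors_def m_comm)

lemma regular_cancel:
  assumes "s \<in> regular_elements R" "a \<in> carrier R" "b \<in> carrier R" "a \<otimes> s = b \<otimes> s"
  shows "a = b"
proof -
  have s: "s \<in> carrier R" using assms(1) by (rule regular_carrier)
  have "(a \<ominus> b) \<otimes> s = a \<otimes> s \<ominus> b \<otimes> s"
    using assms(2,3) s by algebra
  also have "\<dots> = \<zero>" using assms s by (simp add: r_neg a_minus_def)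
  finally have ab: "a \<ominus> b = \<zero>" using regular_zeroD[OF assms(1)] assms(2,3) by simp
  have "(a \<ominus> b) \<oplus> b = a" using assms(2,3) by (simp add: a_minus_def a_assoc l_neg)
  then show ?thesis using assms(3) unfolding ab by simp
qed

lemma regular_one: "\<one> \<in> regular_elements R"
  by (auto simp: regular_elements_def zero_divisors_def)

lemma regular_mult:
  assumes "s \<in> regular_elements R" "t \<in> regular_elements R"
  shows "s \<otimes> t \<in> regular_elements R"
proof -
  have st: "s \<in> carrier R" "t \<in> carrier R" using assms by (auto intro: regular_carrier)
  have "b = \<zero>" if b: "b \<in> carrier R" and z: "s \<otimes> t \<otimes> b = \<zero>" for b
  proof -
    have "(b \<otimes> s) \<otimes> t = \<zero>" using st b z by (simp add: m_ac)
    then have "b \<otimes> s = \<zero>" using regular_zeroD[OF assms(2)] b st by simp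
    then show ?thesis using regular_zeroD[OF assms(1)] b by simp
  qed
  then show ?thesis using st by (auto simp: regular_elements_def zero_divisors_def)
qed

lemma equiv_frac_rel: "equiv (carrier R \<times> regular_elements R) (frac_rel R)"
proof (rule equivI)
  show "frac_rel R \<subseteq> (carrier R \<times> regular_elements R) \<times> (carrier R \<times> regular_elements R)"
    by (auto simp: frac_rel_def)
  show "refl_on (carrier R \<times> regular_elements R) (frac_rel R)"
    by (auto simp: refl_on_def frac_rel_def)
  show "sym (frac_rel R)"
    by (auto simp: sym_def frac_rel_def)
  show "trans (frac_rel R)"
  proof (rule transI)
    fix x y z assume xy: "(x, y) \<in> frac_rel R" and yz: "(y, z) \<in> frac_rel R"
    obtain a s b t c u where e: "x = (a, s)" "y = (b, t)" "z = (c, u)"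
      by (metis surj_pair)
    have c: "a \<in> carrier R" "b \<in> carrier R" "c \<in> carrier R"
      "s \<in> regular_elements R" "t \<in> regular_elements R" "u \<in> regular_elements R"
      and 1: "a \<otimes> t = b \<otimes> s" and 2: "b \<otimes> u = c \<otimes> t"
      using xy yz e by (auto simp: frac_rel_def)
    note c' = c(1-3) c(4-6)[THEN regular_carrier]
    have "(a \<otimes> u) \<otimes> t = (a \<otimes> t) \<otimes> u" using c' by (simp add: m_ac)
    also have "\<dots> = (b \<otimes> u) \<otimes> s" using c' by (simp add: 1 m_ac)
    also have "\<dots> = (c \<otimes> s) \<otimes> t" using c' by (simp add: 2 m_ac)
    finally have "a \<otimes> u = c \<otimes> s"
      by (rule regular_cancel[rotated 3]) (use c c' in simp_all)
    then show "(x, z) \<in> frac_rel R" using c e by (simp add: frac_rel_def)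
  qed
qed

lemma fraction_eq_iff:
  assumes "a \<in> carrier R" "s \<in> regular_elements R" "b \<in> carrier R" "t \<in> regular_elements R"
  shows "fraction R a s = fraction R b t \<longleftrightarrow> a \<otimes> t = b \<otimes> s"
  unfolding fraction_def
  using eq_equiv_class_iff[OF equiv_frac_rel, of "(a, s)" "(b, t)"] assms
  by (simp add: frac_rel_def)

lemma fraction_mem:
  assumes "a \<in> carrier R" "s \<in> regular_elements R"
  shows "(a, s) \<in> fraction R a s"
  using assms by (simp add: fraction_def frac_rel_def)

lemma fraction_memD:
  assumes "(b, t) \<in> fraction R a s"
  shows "b \<in> carrier R" "t \<in> regular_elements R" "a \<otimes> t = b \<otimes> s"
  using assms by (auto simp: fraction_def frac_rel_def)

lemma fraction_closed:
  assumes "a \<in> carrier R" "s \<in> regular_elements R"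
  shows "fraction R a s \<in> carrier (total_quotient_ring R)"
  using assms by (auto simp: total_quotient_ring_def fraction_def intro!: quotientI)

lemma total_quotient_cases:
  assumes "X \<in> carrier (total_quotient_ring R)"
  obtains a s where "a \<in> carrier R" "s \<in> regular_elements R" "X = fraction R a s"
  using assms by (auto simp: total_quotient_ring_def fraction_def elim!: quotientE)

lemma UN_pairs_const:
  assumes "x \<in> X" "y \<in> Y"
    and "\<And>a s b t. \<lbrakk>(a, s) \<in> X; (b, t) \<in> Y\<rbrakk> \<Longrightarrow> f a s b t = F"
  shows "(\<Union>(a, s) \<in> X. \<Union>(b, t) \<in> Y. f a s b t) = F"
proof -
  have "(case p of (a, s) \<Rightarrow> \<Union>(b, t) \<in> Y. f a s b t) = F" if "p \<in> X" for p
  proof -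
    obtain a s where p: "p = (a, s)" by (cases p)
    have "(case q of (b, t) \<Rightarrow> f a s b t) = F" if "q \<in> Y" for q
      using assms(3) \<open>p \<in> X\<close> that p by (cases q) simp
    then have "(\<Union>(b, t) \<in> Y. f a s b t) = F" using assms(2) by auto
    then show ?thesis using p by simp
  qed
  then show ?thesis using assms(1) by auto
qed

lemma fraction_mult:
  assumes "a \<in> carrier R" "s \<in> regular_elements R" "b \<in> carrier R" "t \<in> regular_elements R"
  shows "fraction R a s \<otimes>\<^bsub>total_quotient_ring R\<^esub> fraction R b t = fraction R (a \<otimes> b) (s \<otimes> t)"
proof -
  have "fraction R (a' \<otimes> b') (s' \<otimes> t') = fraction R (a \<otimes> b) (s \<otimes> t)"
    if 1: "(a', s') \<in> fraction R a s" and 2: "(b', t') \<in> fraction R b t" for a' s' b' t'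
  proof -
    note m = fraction_memD[OF 1] fraction_memD[OF 2]
    note c = m(1,2,4,5) assms m(2,5)[THEN regular_carrier] assms(2,4)[THEN regular_carrier]
    have "(a' \<otimes> b') \<otimes> (s \<otimes> t) = (a' \<otimes> s) \<otimes> (b' \<otimes> t)" using c by (simp add: m_ac)
    also have "\<dots> = (a \<otimes> s') \<otimes> (b \<otimes> t')" by (simp add: m(3,6))
    also have "\<dots> = (a \<otimes> b) \<otimes> (s' \<otimes> t')" using c by (simp add: m_ac)
    finally show ?thesis
      using c by (subst fraction_eq_iff) (auto intro: regular_mult)
  qed
  then show ?thesis
    unfolding total_quotient_ring_def
    by (simp, intro UN_pairs_const[OF fraction_mem[OF assms(1,2)] fraction_mem[OF assms(3,4)]])
qed

lemma fraction_add:
  assumes "a \<in> carrier R" "s \<in> regular_elements R" "b \<in> carrier R" "t \<in> regular_elements R"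
  shows "fraction R a s \<oplus>\<^bsub>total_quotient_ring R\<^esub> fraction R b t = fraction R (a \<otimes> t \<oplus> b \<otimes> s) (s \<otimes> t)"
proof -
  have "fraction R (a' \<otimes> t' \<oplus> b' \<otimes> s') (s' \<otimes> t') = fraction R (a \<otimes> t \<oplus> b \<otimes> s) (s \<otimes> t)"
    if 1: "(a', s') \<in> fraction R a s" and 2: "(b', t') \<in> fraction R b t" for a' s' b' t'
  proof -
    note m = fraction_memD[OF 1] fraction_memD[OF 2]
    note c = m(1,2,4,5) assms m(2,5)[THEN regular_carrier] assms(2,4)[THEN regular_carrier]
    have "(a' \<otimes> t' \<oplus> b' \<otimes> s') \<otimes> (s \<otimes> t)
        = (a' \<otimes> s) \<otimes> (t \<otimes> t') \<oplus> (b' \<otimes> t) \<otimes> (s \<otimes> s')"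
      using c by algebra
    also have "\<dots> = (a \<otimes> s') \<otimes> (t \<otimes> t') \<oplus> (b \<otimes> t') \<otimes> (s \<otimes> s')" by (simp add: m(3,6))
    also have "\<dots> = (a \<otimes> t \<oplus> b \<otimes> s) \<otimes> (s' \<otimes> t')" using c by algebra
    finally show ?thesis
      using c by (subst fraction_eq_iff) (auto intro: regular_mult)
  qed
  then show ?thesis
    unfolding total_quotient_ring_def
    by (simp, intro UN_pairs_const[OF fraction_mem[OF assms(1,2)] fraction_mem[OF assms(3,4)]])
qed

lemma total_quotient_one: "\<one>\<^bsub>total_quotient_ring R\<^esub> = fraction R \<one> \<one>"
  and total_quotient_zero: "\<zero>\<^bsub>total_quotient_ring R\<^esub> = fraction R \<zero> \<one>"
  by (simp_all add: total_quotient_ring_def)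

lemma total_quotient_ring_cring: "cring (total_quotient_ring R)" (is "cring ?T")
proof -
  note [simp] = fraction_mult fraction_add total_quotient_one total_quotient_zero fraction_closed
    regular_one regular_mult regular_carrier
  show ?thesis
  proof (rule cringI)
    show "abelian_group ?T"
    proof (rule abelian_groupI)
      fix X Y assume "X \<in> carrier ?T" "Y \<in> carrier ?T"
      then obtain a s b t where X: "a \<in> carrier R" "s \<in> regular_elements R" "X = fraction R a s"
        and Y: "b \<in> carrier R" "t \<in> regular_elements R" "Y = fraction R b t"
        by (meson total_quotient_cases)
      show "X \<oplus>\<^bsub>?T\<^esub> Y \<in> carrier ?T" using X Y by simp
      show "X \<oplus>\<^bsub>?T\<^esub> Y = Y \<oplus>\<^bsub>?T\<^esub> X"
        using X Y m_comm[of s t] a_comm[of "a \<otimes> t" "b \<otimes> s"] by simp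
    next
      fix X Y Z assume "X \<in> carrier ?T" "Y \<in> carrier ?T" "Z \<in> carrier ?T"
      then obtain a s b t c u where X: "a \<in> carrier R" "s \<in> regular_elements R" "X = fraction R a s"
        and Y: "b \<in> carrier R" "t \<in> regular_elements R" "Y = fraction R b t"
        and Z: "c \<in> carrier R" "u \<in> regular_elements R" "Z = fraction R c u"
        by (meson total_quotient_cases)
      note d = X(2)[THEN regular_carrier] Y(2)[THEN regular_carrier] Z(2)[THEN regular_carrier]
      have "((a \<otimes> t \<oplus> b \<otimes> s) \<otimes> u \<oplus> c \<otimes> (s \<otimes> t)) \<otimes> (s \<otimes> (t \<otimes> u))
          = (a \<otimes> (t \<otimes> u) \<oplus> (b \<otimes> u \<oplus> c \<otimes> t) \<otimes> s) \<otimes> (s \<otimes> t \<otimes> u)"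
        using X(1) Y(1) Z(1) d by algebra
      then have "fraction R ((a \<otimes> t \<oplus> b \<otimes> s) \<otimes> u \<oplus> c \<otimes> (s \<otimes> t)) (s \<otimes> t \<otimes> u)
          = fraction R (a \<otimes> (t \<otimes> u) \<oplus> (b \<otimes> u \<oplus> c \<otimes> t) \<otimes> s) (s \<otimes> (t \<otimes> u))"
        by (subst fraction_eq_iff) (use X(1,2) Y(1,2) Z(1,2) d in simp_all)
      then show "X \<oplus>\<^bsub>?T\<^esub> Y \<oplus>\<^bsub>?T\<^esub> Z = X \<oplus>\<^bsub>?T\<^esub> (Y \<oplus>\<^bsub>?T\<^esub> Z)"
        using X Y Z d by simp
    next
      fix X assume "X \<in> carrier ?T"
      then obtain a s where X: "a \<in> carrier R" "s \<in> regular_elements R" "X = fraction R a s"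
        by (rule total_quotient_cases)
      note s = X(2)[THEN regular_carrier]
      show "\<zero>\<^bsub>?T\<^esub> \<oplus>\<^bsub>?T\<^esub> X = X" using X s by simp
      have "\<ominus> a \<otimes> s \<oplus> a \<otimes> s = \<zero>" using X(1) s by algebra
      then have "fraction R (\<ominus> a \<otimes> s \<oplus> a \<otimes> s) (s \<otimes> s) = fraction R \<zero> \<one>"
        using X(1,2) s by (subst fraction_eq_iff) simp_all
      then have "fraction R (\<ominus> a) s \<oplus>\<^bsub>?T\<^esub> X = \<zero>\<^bsub>?T\<^esub>" using X s by simp
      then show "\<exists>Y \<in> carrier ?T. Y \<oplus>\<^bsub>?T\<^esub> X = \<zero>\<^bsub>?T\<^esub>" using X by (meson a_inv_closed fraction_closed)
    qed simp
    show "comm_monoid ?T"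
    proof (rule comm_monoidI)
      fix X Y assume "X \<in> carrier ?T" "Y \<in> carrier ?T"
      then obtain a s b t where X: "a \<in> carrier R" "s \<in> regular_elements R" "X = fraction R a s"
        and Y: "b \<in> carrier R" "t \<in> regular_elements R" "Y = fraction R b t"
        by (meson total_quotient_cases)
      show "X \<otimes>\<^bsub>?T\<^esub> Y \<in> carrier ?T" using X Y by simp
      show "X \<otimes>\<^bsub>?T\<^esub> Y = Y \<otimes>\<^bsub>?T\<^esub> X" using X Y m_comm[of s t] m_comm[of a b] by simp
    next
      fix X Y Z assume "X \<in> carrier ?T" "Y \<in> carrier ?T" "Z \<in> carrier ?T"
      then obtain a s b t c u where X: "a \<in> carrier R" "s \<in> regular_elements R" "X = fraction R a s"
        and Y: "b \<in> carrier R" "t \<in> regular_elements R" "Y = fraction R b t"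
        and Z: "c \<in> carrier R" "u \<in> regular_elements R" "Z = fraction R c u"
        by (meson total_quotient_cases)
      then show "X \<otimes>\<^bsub>?T\<^esub> Y \<otimes>\<^bsub>?T\<^esub> Z = X \<otimes>\<^bsub>?T\<^esub> (Y \<otimes>\<^bsub>?T\<^esub> Z)"
        by (simp add: m_assoc)
    next
      fix X assume "X \<in> carrier ?T"
      then obtain a s where "a \<in> carrier R" "s \<in> regular_elements R" "X = fraction R a s"
        by (rule total_quotient_cases)
      then show "\<one>\<^bsub>?T\<^esub> \<otimes>\<^bsub>?T\<^esub> X = X" by simp
    qed simp
  next
    fix X Y Z assume "X \<in> carrier ?T" "Y \<in> carrier ?T" "Z \<in> carrier ?T"
    then obtain a s b t c u where X: "a \<in> carrier R" "s \<in> regular_elements R" "X = fraction R a s"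
      and Y: "b \<in> carrier R" "t \<in> regular_elements R" "Y = fraction R b t"
      and Z: "c \<in> carrier R" "u \<in> regular_elements R" "Z = fraction R c u"
      by (meson total_quotient_cases)
    note d = X(2)[THEN regular_carrier] Y(2)[THEN regular_carrier] Z(2)[THEN regular_carrier]
    have "((a \<otimes> t \<oplus> b \<otimes> s) \<otimes> c) \<otimes> ((s \<otimes> u) \<otimes> (t \<otimes> u))
        = (a \<otimes> c \<otimes> (t \<otimes> u) \<oplus> b \<otimes> c \<otimes> (s \<otimes> u)) \<otimes> (s \<otimes> t \<otimes> u)"
      using X(1) Y(1) Z(1) d by algebra
    then have "fraction R ((a \<otimes> t \<oplus> b \<otimes> s) \<otimes> c) (s \<otimes> t \<otimes> u)
        = fraction R (a \<otimes> c \<otimes> (t \<otimes> u) \<oplus> b \<otimes> c \<otimes> (s \<otimes> u)) ((s \<otimes> u) \<otimes> (t \<otimes> u))"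
      by (subst fraction_eq_iff) (use X(1,2) Y(1,2) Z(1,2) d in simp_all)
    then show "(X \<oplus>\<^bsub>?T\<^esub> Y) \<otimes>\<^bsub>?T\<^esub> Z = X \<otimes>\<^bsub>?T\<^esub> Z \<oplus>\<^bsub>?T\<^esub> Y \<otimes>\<^bsub>?T\<^esub> Z"
      using X Y Z d by simp
  qed
qed

end

section \<open>The space of minimal prime ideals\<close>

definition minimal_primes :: "('a, 'm) ring_scheme \<Rightarrow> 'a set set" where
  "minimal_primes R =
    {P. primeideal P R \<and> (\<forall>Q. primeideal Q R \<longrightarrow> Q \<subseteq> P \<longrightarrow> Q = P)}"

definition basic_open :: "('a, 'm) ring_scheme \<Rightarrow> 'a \<Rightarrow> 'a set set" where
  "basic_open R a = {P \<in> minimal_primes R. a \<notin> P}"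

definition minimal_prime_space :: "('a, 'm) ring_scheme \<Rightarrow> 'a set topology" where
  "minimal_prime_space R =
    topology (arbitrary union_of (\<lambda>U. \<exists>a \<in> carrier R. U = basic_open R a))"

text \<open>\<^const>\<open>topology\<close> is only meaningful on families that form a topology; this one does,
  and its underlying set is all of \<open>minimal_primes R\<close>.\<close>

context cring
begin

lemma basic_open_Int:
  assumes "a \<in> carrier R" "b \<in> carrier R"
  shows "basic_open R a \<inter> basic_open R b = basic_open R (a \<otimes> b)"
proof -
  have "a \<otimes> b \<in> P \<longleftrightarrow> a \<in> P \<or> b \<in> P" if "P \<in> minimal_primes R" for P
  proof -
    interpret P: primeideal P R using that by (simp add: minimal_primes_def)
    show ?thesis using assms P.I_prime[of a b] P.I_l_closed[of b a] P.I_r_closed[of a b] by auto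
  qed
  then show ?thesis by (auto simp: basic_open_def)
qed

lemma basic_open_one: "basic_open R \<one> = minimal_primes R"
proof -
  have "\<one> \<notin> P" if "P \<in> minimal_primes R" for P
  proof -
    interpret P: primeideal P R using that by (simp add: minimal_primes_def)
    show ?thesis using P.one_imp_carrier P.I_notcarr by metis
  qed
  then show ?thesis by (auto simp: basic_open_def)
qed

lemma openin_minimal_prime_space:
  "openin (minimal_prime_space R) =
    arbitrary union_of (\<lambda>U. \<exists>a \<in> carrier R. U = basic_open R a)"
  unfolding minimal_prime_space_def
proof (rule topology_inverse', rule istopology_base)
  fix S T assume "\<exists>a \<in> carrier R. S = basic_open R a" "\<exists>a \<in> carrier R. T = basic_open R a"
  then obtain a b where "a \<in> carrier R" "b \<in> carrier R" "S = basic_open R a" "T = basic_open R b"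
    by blast
  then show "\<exists>a \<in> carrier R. S \<inter> T = basic_open R a"
    using basic_open_Int by (intro bexI[of _ "a \<otimes> b"]) simp_all
qed

lemma topspace_minimal_prime_space: "topspace (minimal_prime_space R) = minimal_primes R"
proof
  show "topspace (minimal_prime_space R) \<subseteq> minimal_primes R"
    unfolding topspace_def openin_minimal_prime_space union_of_def basic_open_def by blast
  have "openin (minimal_prime_space R) (basic_open R \<one>)"
    unfolding openin_minimal_prime_space
    by (rule union_of_inc) (use one_closed in \<open>auto simp: arbitrary_def\<close>)
  then show "minimal_primes R \<subseteq> topspace (minimal_prime_space R)"
    unfolding basic_open_one by (rule openin_subset)
qed

end

section \<open>Properties (A) and (a.c.), strongly dense ideals\<close>

definition finitely_generated_ideal :: "('a, 'm) ring_scheme \<Rightarrow> 'a set \<Rightarrow> bool" where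
  "finitely_generated_ideal R I \<longleftrightarrow>
    (\<exists>S. finite S \<and> S \<subseteq> carrier R \<and> I = Idl\<^bsub>R\<^esub> S)"

definition property_A :: "('a, 'm) ring_scheme \<Rightarrow> bool" where
  "property_A R \<longleftrightarrow>
    (\<forall>I. finitely_generated_ideal R I \<and> I \<subseteq> zero_divisors R \<longrightarrow> ann R I \<noteq> {\<zero>\<^bsub>R\<^esub>})"

definition property_ac :: "('a, 'm) ring_scheme \<Rightarrow> bool" where
  "property_ac R \<longleftrightarrow>
    (\<forall>I. finitely_generated_ideal R I \<longrightarrow> (\<exists>c \<in> carrier R. ann R I = ann R {c}))"

definition sd_ideal :: "('a, 'm) ring_scheme \<Rightarrow> 'a set \<Rightarrow> bool" where
  "sd_ideal R I \<longleftrightarrow>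
    ideal I R \<and> I \<subseteq> zero_divisors R \<and> \<not> (\<exists>P \<in> minimal_primes R. I \<subseteq> P)"

end

theory Submission
  imports Defs
begin

text \<open>
  Every condition is compared with one elementary condition on \<open>R\<close>: each \<open>a\<close> has a complement,
  that is, an element \<open>b\<close> with \<open>a b = 0\<close> and \<open>a + b\<close> regular.  For a von Neumann regular
  \<open>T(R)\<close> this is the familiar splitting of an element by an idempotent, with the denominators
  cleared; conversely \<open>a (a + b) = a\<^sup>2\<close> makes \<open>1/(a + b)\<close> a quasi-inverse of \<open>a\<close>.

  The link with minimal primes is a single application of Zorn's lemma: in a reduced ring every
  multiplicative set avoiding \<open>0\<close> is disjoint from some minimal prime.  It shows that the minimal
  primes intersect in \<open>0\<close>, and that an element of a minimal prime \<open>P\<close> is killed by an element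
  outside \<open>P\<close>.  Consequently the ideal \<open>a R + ann(a)\<close> lies in no minimal prime; if there are no
  sd-ideals, it contains a regular element \<open>a x + b\<close>, and then \<open>b\<close> is a complement of \<open>a\<close>.
  In the other direction, given complements and an ideal \<open>I\<close> of zero divisors, the complements of
  the elements of \<open>I\<close> form a multiplicative set avoiding \<open>0\<close>, and a minimal prime disjoint from
  it contains \<open>I\<close>.

  Compactness of \<open>\<M>\<close> says that a set of elements contained in no minimal prime has a finite subset
  contained in no minimal prime, and a set contained in no minimal prime has zero annihilator.
  Without sd-ideals, a set in no minimal prime generates an ideal containing a regular element, and
  finitely many generators suffice for that element, which gives compactness; property (A) holds
  since finitely many elements of a minimal prime \<open>P\<close> have a common annihilator outside \<open>P\<close>.
  Conversely, compactness reduces an sd-ideal to a finitely generated ideal contradicting (A).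
  With complements, \<open>ann(a, c) = ann(a + b c)\<close> for a complement \<open>b\<close> of \<open>a\<close>, which gives (a.c.) by
  induction.  Finally, under compactness finitely many elements of \<open>ann(a)\<close> together with \<open>a\<close> lie in
  no minimal prime, and (a.c.) replaces them by a single element, which is a complement of \<open>a\<close>.
\<close>

section \<open>Reduced rings and complements\<close>

locale reduced_cring = cring +
  assumes reduced: "reduced_ring R"

definition complement :: "('a, 'm) ring_scheme \<Rightarrow> 'a \<Rightarrow> 'a \<Rightarrow> bool" where
  "complement R a b \<longleftrightarrow>
    b \<in> carrier R \<and> a \<otimes>\<^bsub>R\<^esub> b = \<zero>\<^bsub>R\<^esub> \<and> a \<oplus>\<^bsub>R\<^esub> b \<in> regular_elements R"

lemma (in cring) regularI:
  assumes "s \<in> carrier R" and "\<And>y. \<lbrakk>y \<in> carrier R; y \<otimes> s = \<zero>\<rbrakk> \<Longrightarrow> y = \<zero>"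
  shows "s \<in> regular_elements R"
  using assms by (auto simp: regular_elements_def zero_divisors_def m_comm)

context reduced_cring
begin

lemma pow_eq_zeroD: "\<lbrakk>x \<in> carrier R; x [^] (n::nat) = \<zero>\<rbrakk> \<Longrightarrow> x = \<zero>"
  using reduced by (auto simp: reduced_ring_def)

lemma square_eq_zeroD: "\<lbrakk>x \<in> carrier R; x \<otimes> x = \<zero>\<rbrakk> \<Longrightarrow> x = \<zero>"
  using pow_eq_zeroD[of x 2] by (simp add: numeral_2_eq_2)

lemma mult_pow_eq_zeroD:
  assumes "s \<in> carrier R" "x \<in> carrier R" "s \<otimes> x [^] (n::nat) = \<zero>"
  shows "s \<otimes> x = \<zero>"
proof (rule pow_eq_zeroD)
  have "(s \<otimes> x) [^] Suc n = (s [^] n \<otimes> x) \<otimes> (s \<otimes> x [^] n)"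
    using assms(1,2) by (simp add: nat_pow_distrib m_ac)
  then show "(s \<otimes> x) [^] Suc n = \<zero>" using assms by simp
qed (use assms in simp)

text \<open>Multiplying \<open>y (a + b) = 0\<close> by \<open>a\<close> gives \<open>y a\<^sup>2 = 0\<close>, so reducedness separates the
  annihilators of two orthogonal elements.\<close>

lemma mult_orthogonal_sum_eq_zeroD:
  assumes c: "a \<in> carrier R" "b \<in> carrier R" "y \<in> carrier R"
    and ab: "a \<otimes> b = \<zero>" and y: "y \<otimes> (a \<oplus> b) = \<zero>"
  shows "y \<otimes> a = \<zero>" "y \<otimes> b = \<zero>"
proof -
  have "(y \<otimes> a) \<otimes> (y \<otimes> a) = y \<otimes> a \<otimes> (y \<otimes> (a \<oplus> b)) \<ominus> y \<otimes> y \<otimes> (a \<otimes> b)"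
    using c by algebra
  then have "(y \<otimes> a) \<otimes> (y \<otimes> a) = \<zero>" using c by (simp add: ab y a_minus_def)
  then show ya: "y \<otimes> a = \<zero>" using square_eq_zeroD[of "y \<otimes> a"] c by simp
  show "y \<otimes> b = \<zero>" using y ya c by (simp add: r_distr)
qed

lemma complementI:
  assumes "a \<in> carrier R" "b \<in> carrier R" "a \<otimes> b = \<zero>"
    and "\<And>y. \<lbrakk>y \<in> carrier R; y \<otimes> a = \<zero>; y \<otimes> b = \<zero>\<rbrakk> \<Longrightarrow> y = \<zero>"
  shows "complement R a b"
proof -
  have "a \<oplus> b \<in> regular_elements R"
  proof (rule regularI)
    show "y = \<zero>" if "y \<in> carrier R" "y \<otimes> (a \<oplus> b) = \<zero>" for y
      using assms(4) mult_orthogonal_sum_eq_zeroD[OF assms(1,2) that(1) assms(3) that(2)] that(1)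
      by blast
  qed (use assms in simp)
  then show ?thesis using assms(2,3) by (simp add: complement_def)
qed

section \<open>Von Neumann regularity of the total quotient ring\<close>

text \<open>A quasi-inverse \<open>x/s\<close> of \<open>a/1\<close> satisfies \<open>a s = a x a\<close>, so \<open>s - a x\<close> is orthogonal to \<open>a\<close>;
  it is a complement since whatever kills both of them kills \<open>s\<close>.  Conversely, \<open>s/(a + b)\<close> is a
  quasi-inverse of \<open>a/s\<close> for every complement \<open>b\<close> of \<open>a\<close>.\<close>

lemma von_neumann_regular_iff_complement:
  "von_neumann_regular (total_quotient_ring R) \<longleftrightarrow> (\<forall>a \<in> carrier R. \<exists>b. complement R a b)"
proof (intro iffI ballI)
  fix a assume vnr: "von_neumann_regular (total_quotient_ring R)" and a: "a \<in> carrier R"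
  let ?T = "total_quotient_ring R" and ?a = "fraction R a \<one>"
  obtain X where X: "X \<in> carrier ?T" "?a = ?a \<otimes>\<^bsub>?T\<^esub> X \<otimes>\<^bsub>?T\<^esub> ?a"
    using vnr fraction_closed[OF a regular_one] by (auto simp: von_neumann_regular_def)
  obtain x s where x: "x \<in> carrier R" "s \<in> regular_elements R" "X = fraction R x s"
    using X(1) by (rule total_quotient_cases)
  note s = x(2)[THEN regular_carrier]
  have "fraction R a \<one> = fraction R (a \<otimes> x \<otimes> a) s"
    using X(2) a x s by (simp add: fraction_mult regular_one regular_mult)
  then have eq: "a \<otimes> s = a \<otimes> x \<otimes> a"
    using a x s by (simp add: fraction_eq_iff regular_one)
  have "complement R a (s \<ominus> a \<otimes> x)"
  proof (rule complementI)
    have "a \<otimes> (s \<ominus> a \<otimes> x) = a \<otimes> s \<ominus> a \<otimes> x \<otimes> a" using a x s by algebra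
    then show "a \<otimes> (s \<ominus> a \<otimes> x) = \<zero>" using a x s by (simp add: eq r_neg a_minus_def)
    fix y assume y: "y \<in> carrier R" "y \<otimes> a = \<zero>" "y \<otimes> (s \<ominus> a \<otimes> x) = \<zero>"
    have "y \<otimes> s = y \<otimes> (s \<ominus> a \<otimes> x) \<oplus> y \<otimes> a \<otimes> x" using a x s y(1) by algebra
    then have "y \<otimes> s = \<zero>" using x by (simp add: y)
    then show "y = \<zero>" using regular_zeroD x(2) y(1) by blast
  qed (use a x s in simp_all)
  then show "\<exists>b. complement R a b" ..
next
  assume compl: "\<forall>a \<in> carrier R. \<exists>b. complement R a b"
  let ?T = "total_quotient_ring R"
  have "\<exists>X \<in> carrier ?T. A = A \<otimes>\<^bsub>?T\<^esub> X \<otimes>\<^bsub>?T\<^esub> A" if A: "A \<in> carrier ?T" for A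
  proof -
    obtain a s where a: "a \<in> carrier R" "s \<in> regular_elements R" "A = fraction R a s"
      using A by (rule total_quotient_cases)
    note s = a(2)[THEN regular_carrier]
    obtain b where b: "b \<in> carrier R" "a \<otimes> b = \<zero>" "a \<oplus> b \<in> regular_elements R"
      using compl a(1) by (auto simp: complement_def)
    have "a \<otimes> (s \<otimes> (a \<oplus> b) \<otimes> s) = a \<otimes> s \<otimes> a \<otimes> s \<oplus> a \<otimes> b \<otimes> s \<otimes> s"
      using a(1) b(1) s by algebra
    also have "\<dots> = a \<otimes> s \<otimes> a \<otimes> s" using a(1) s by (simp add: b(2))
    finally have "A = A \<otimes>\<^bsub>?T\<^esub> fraction R s (a \<oplus> b) \<otimes>\<^bsub>?T\<^esub> A"
      using a b s by (simp add: fraction_mult regular_mult fraction_eq_iff)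
    then show ?thesis using fraction_closed s b(3) by blast
  qed
  then show "von_neumann_regular ?T"
    using total_quotient_ring_cring by (auto simp: von_neumann_regular_def cring_def)
qed

section \<open>Minimal primes of a reduced ring\<close>

text \<open>The new products have the form \<open>s x\<^sup>n\<close>, and in a reduced ring \<open>s x\<^sup>n = 0\<close> already forces
  \<open>s x = 0\<close>.\<close>

lemma submonoid_adjoin_avoiding_zero:
  assumes S: "submonoid S R" and x: "x \<in> carrier R" and nz: "\<And>s. s \<in> S \<Longrightarrow> s \<otimes> x \<noteq> \<zero>"
  obtains U where "submonoid U R" "\<zero> \<notin> U" "S \<subseteq> U" "x \<in> U"
proof -
  interpret S: submonoid S R by (rule S)
  define U where "U = {u. \<exists>s \<in> S. \<exists>n::nat. u = s \<otimes> x [^] n}"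
  have "submonoid U R"
  proof
    show "U \<subseteq> carrier R" using x S.subset by (auto simp: U_def)
    have "\<one> = \<one> \<otimes> x [^] (0::nat)" by simp
    then show "\<one> \<in> U" unfolding U_def using S.one_closed by blast
    fix u v assume "u \<in> U" "v \<in> U"
    then obtain s n t m where u: "s \<in> S" "u = s \<otimes> x [^] (n::nat)" "t \<in> S" "v = t \<otimes> x [^] (m::nat)"
      unfolding U_def by blast
    have c: "s \<in> carrier R" "t \<in> carrier R" "x [^] n \<in> carrier R" "x [^] m \<in> carrier R"
      using x u S.subset by auto
    have "u \<otimes> v = (s \<otimes> t) \<otimes> (x [^] n \<otimes> x [^] m)"
      unfolding u(2,4) using c by (simp add: m_ac)
    then have "u \<otimes> v = (s \<otimes> t) \<otimes> x [^] (n + m)" using x by (simp add: nat_pow_mult)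
    then show "u \<otimes> v \<in> U" unfolding U_def using S.m_closed[OF u(1,3)] by blast
  qed
  moreover have "\<zero> \<notin> U"
  proof
    assume "\<zero> \<in> U"
    then obtain s n where s: "s \<in> S" "\<zero> = s \<otimes> x [^] (n::nat)" unfolding U_def by blast
    then have "s \<otimes> x = \<zero>" using mult_pow_eq_zeroD[of s x n] x S.subset by auto
    then show False using nz[OF s(1)] by simp
  qed
  moreover have "S \<subseteq> U"
  proof
    fix s assume "s \<in> S"
    moreover have "s = s \<otimes> x [^] (0::nat)" using \<open>s \<in> S\<close> S.subset by auto
    ultimately show "s \<in> U" unfolding U_def by blast
  qed
  moreover have "x = \<one> \<otimes> x [^] (1::nat)" using x by simp
  then have "x \<in> U" unfolding U_def using S.one_closed by blast
  ultimately show ?thesis by (rule that)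
qed

lemma complement_of_prime_submonoid:
  assumes "primeideal P R"
  shows "submonoid (carrier R - P) R"
proof
  interpret P: primeideal P R by (rule assms)
  show "\<one> \<in> carrier R - P" using P.one_imp_carrier P.I_notcarr by auto
  show "\<And>x y. \<lbrakk>x \<in> carrier R - P; y \<in> carrier R - P\<rbrakk> \<Longrightarrow> x \<otimes> y \<in> carrier R - P"
    using P.I_prime by auto
qed auto

lemma maximal_submonoid_avoiding_zero:
  assumes "submonoid S R" "\<zero> \<notin> S"
  obtains T where "submonoid T R" "\<zero> \<notin> T" "S \<subseteq> T"
    and "\<And>U. \<lbrakk>submonoid U R; \<zero> \<notin> U; T \<subseteq> U\<rbrakk> \<Longrightarrow> U = T"
proof -
  let ?A = "{T. submonoid T R \<and> \<zero> \<notin> T \<and> S \<subseteq> T}"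
  have "\<exists>M \<in> ?A. \<forall>X \<in> ?A. M \<subseteq> X \<longrightarrow> X = M"
  proof (rule subset_Zorn_nonempty)
    show "?A \<noteq> {}" using assms by blast
    fix C assume C: "C \<noteq> {}" "subset.chain ?A C"
    then have sub: "\<And>X. X \<in> C \<Longrightarrow> submonoid X R \<and> \<zero> \<notin> X \<and> S \<subseteq> X"
      and lin: "\<And>X Y. \<lbrakk>X \<in> C; Y \<in> C\<rbrakk> \<Longrightarrow> X \<subseteq> Y \<or> Y \<subseteq> X"
      by (auto simp: subset_chain_def)
    have "submonoid (\<Union>C) R"
    proof
      show "\<Union>C \<subseteq> carrier R" using sub submonoid.subset by blast
      show "\<one> \<in> \<Union>C" using sub submonoid.one_closed C(1) by blast
      fix x y assume "x \<in> \<Union>C" "y \<in> \<Union>C"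
      then obtain X where X: "X \<in> C" "x \<in> X" "y \<in> X" using lin by blast
      then have "x \<otimes> y \<in> X" using sub submonoid.m_closed[of X R x y] by simp
      then show "x \<otimes> y \<in> \<Union>C" using X(1) by blast
    qed
    moreover have "\<zero> \<notin> \<Union>C" "S \<subseteq> \<Union>C" using sub C(1) by auto
    ultimately show "\<Union>C \<in> ?A" by simp
  qed
  then obtain M where M: "M \<in> ?A" "\<forall>X \<in> ?A. M \<subseteq> X \<longrightarrow> X = M" by (rule bexE)
  show ?thesis
  proof (rule that)
    show "U = M" if "submonoid U R" "\<zero> \<notin> U" "M \<subseteq> U" for U
      using M that by (metis (no_types, lifting) mem_Collect_eq subset_trans)
  qed (use M(1) in auto)
qed

text \<open>A multiplicative set \<open>T\<close> that is maximal among those avoiding \<open>0\<close> contains every \<open>x\<close> that no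
  element of \<open>T\<close> kills, as such an \<open>x\<close> could otherwise be adjoined to \<open>T\<close>.  Its complement
  therefore consists of the elements killed by some element of \<open>T\<close>, which makes it an ideal; it is
  a minimal prime because the complement of a smaller prime would be a larger multiplicative set.\<close>

lemma minimal_prime_disjoint_submonoid:
  assumes "submonoid S R" "\<zero> \<notin> S"
  obtains P where "P \<in> minimal_primes R" "P \<inter> S = {}"
proof -
  obtain T where T: "submonoid T R" "\<zero> \<notin> T" "S \<subseteq> T"
    and max: "\<And>U. \<lbrakk>submonoid U R; \<zero> \<notin> U; T \<subseteq> U\<rbrakk> \<Longrightarrow> U = T"
    using maximal_submonoid_avoiding_zero[OF assms] by metis
  interpret T: submonoid T R by (rule T(1))
  let ?P = "carrier R - T"
  have killed: "x \<in> ?P \<longleftrightarrow> (\<exists>t \<in> T. t \<otimes> x = \<zero>)" if x: "x \<in> carrier R" for x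
  proof
    assume "x \<in> ?P"
    show "\<exists>t \<in> T. t \<otimes> x = \<zero>"
    proof (rule ccontr)
      assume "\<not> (\<exists>t \<in> T. t \<otimes> x = \<zero>)"
      then obtain U where U: "submonoid U R" "\<zero> \<notin> U" "T \<subseteq> U" "x \<in> U"
        using submonoid_adjoin_avoiding_zero[OF T(1) x] by metis
      then have "U = T" by (intro max)
      then show False using \<open>x \<in> ?P\<close> U(4) by blast
    qed
  next
    assume "\<exists>t \<in> T. t \<otimes> x = \<zero>"
    then show "x \<in> ?P" using T.m_closed T(2) x by (metis DiffI)
  qed
  have "ideal ?P R"
  proof (rule idealI)
    show "ring R" by (rule ring_axioms)
    show "subgroup ?P (add_monoid R)"
    proof (rule group.subgroupI)
      show "group (add_monoid R)" by (rule a_group)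
      show "?P \<noteq> {}" using T(2) by blast
      fix x assume x: "x \<in> ?P"
      then obtain t where "t \<in> T" "t \<otimes> x = \<zero>" using killed by auto
      moreover have "t \<otimes> (\<ominus> x) = \<ominus> (t \<otimes> x)" using x \<open>t \<in> T\<close> T.subset by (auto simp: r_minus)
      ultimately have "\<ominus> x \<in> ?P" using x by (subst killed) auto
      then show "inv\<^bsub>add_monoid R\<^esub> x \<in> ?P" by (simp add: a_inv_def)
    next
      fix x y assume x: "x \<in> ?P" and y: "y \<in> ?P"
      then obtain t u where tu: "t \<in> T" "t \<otimes> x = \<zero>" "u \<in> T" "u \<otimes> y = \<zero>" using killed by auto
      then have c: "t \<in> carrier R" "u \<in> carrier R" "x \<in> carrier R" "y \<in> carrier R"
        using T.subset x y by auto
      have "(t \<otimes> u) \<otimes> (x \<oplus> y) = u \<otimes> (t \<otimes> x) \<oplus> t \<otimes> (u \<otimes> y)" using c by algebra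
      then have "(t \<otimes> u) \<otimes> (x \<oplus> y) = \<zero>" using tu c by simp
      then have "x \<oplus> y \<in> ?P" using c tu T.m_closed by (subst killed) auto
      then show "x \<otimes>\<^bsub>add_monoid R\<^esub> y \<in> ?P" by simp
    qed auto
    fix a x assume a: "a \<in> ?P" and x: "x \<in> carrier R"
    then obtain t where t: "t \<in> T" "t \<otimes> a = \<zero>" using killed by auto
    then have c: "t \<in> carrier R" "a \<in> carrier R" using T.subset a by auto
    have "t \<otimes> (a \<otimes> x) = \<zero>" using t c x by (simp add: m_assoc[symmetric])
    then show ax: "a \<otimes> x \<in> ?P" using t c x by (subst killed) auto
    then show "x \<otimes> a \<in> ?P" using c x by (simp add: m_comm)
  qed
  then have prime: "primeideal ?P R"
    using T.one_closed T.m_closed T.subset by (intro primeidealI is_cring) blast+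
  have "Q = ?P" if Q: "primeideal Q R" "Q \<subseteq> ?P" for Q
  proof -
    interpret Q: primeideal Q R by (rule Q(1))
    have "T \<subseteq> carrier R - Q" using Q(2) T.subset by blast
    then have "carrier R - Q = T"
      using Q.zero_closed by (intro max complement_of_prime_submonoid[OF Q(1)]) auto
    then show ?thesis using Q.Icarr by auto
  qed
  then have "?P \<in> minimal_primes R" using prime by (auto simp: minimal_primes_def)
  then show ?thesis using that T(3) by blast
qed

lemma minimal_prime_not_containing:
  assumes x: "x \<in> carrier R" "x \<noteq> \<zero>"
  obtains P where "P \<in> minimal_primes R" "x \<notin> P"
proof -
  have "submonoid {\<one>} R" by standard auto
  then obtain U where U: "submonoid U R" "\<zero> \<notin> U" "x \<in> U"
    using submonoid_adjoin_avoiding_zero[of "{\<one>}" x] x by auto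
  obtain P where "P \<in> minimal_primes R" "P \<inter> U = {}"
    using minimal_prime_disjoint_submonoid[OF U(1,2)] by blast
  then show ?thesis using that U(3) by blast
qed

lemma minimal_prime_is_prime: "P \<in> minimal_primes R \<Longrightarrow> primeideal P R"
  unfolding minimal_primes_def by blast

text \<open>If nothing outside \<open>P\<close> killed \<open>a\<close>, \<open>a\<close> could be adjoined to the complement of \<open>P\<close>,
  and a prime disjoint from the resulting multiplicative set would be strictly smaller than \<open>P\<close>.\<close>

lemma minimal_prime_killed:
  assumes P: "P \<in> minimal_primes R" and a: "a \<in> P"
  obtains b where "b \<in> carrier R" "b \<notin> P" "b \<otimes> a = \<zero>"
proof -
  interpret P: primeideal P R using P by (blast dest: minimal_prime_is_prime)
  have "\<exists>b \<in> carrier R - P. b \<otimes> a = \<zero>"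
  proof (rule ccontr)
    assume none: "\<not> (\<exists>b \<in> carrier R - P. b \<otimes> a = \<zero>)"
    obtain U where U: "submonoid U R" "\<zero> \<notin> U" "carrier R - P \<subseteq> U" "a \<in> U"
      using submonoid_adjoin_avoiding_zero[OF complement_of_prime_submonoid[OF P.primeideal_axioms]
          P.Icarr[OF a]] none by metis
    obtain Q where Q: "Q \<in> minimal_primes R" "Q \<inter> U = {}"
      using minimal_prime_disjoint_submonoid[OF U(1,2)] by blast
    interpret Q: primeideal Q R using Q by (blast dest: minimal_prime_is_prime)
    have "Q \<subseteq> P" using Q(2) U(3) Q.Icarr by blast
    then have "Q = P" using P Q.primeideal_axioms by (auto simp: minimal_primes_def)
    then show False using Q(2) U(4) a by blast
  qed
  then show ?thesis using that by blast
qed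

lemma minimal_prime_finite_killed:
  assumes P: "P \<in> minimal_primes R" and "finite F" "F \<subseteq> P"
  obtains b where "b \<in> carrier R" "b \<notin> P" "b \<in> ann R F"
proof -
  interpret P: primeideal P R using P by (blast dest: minimal_prime_is_prime)
  have "\<exists>b \<in> carrier R - P. b \<in> ann R F" using assms(2,3)
  proof induction
    case empty
    then show ?case using P.one_imp_carrier P.I_notcarr by (auto simp: ann_def intro!: bexI[of _ \<one>])
  next
    case (insert a F)
    then obtain b where b: "b \<in> carrier R - P" "b \<in> ann R F" by auto
    obtain c where c: "c \<in> carrier R" "c \<notin> P" "c \<otimes> a = \<zero>"
      using minimal_prime_killed[OF P] insert.prems by blast
    have F: "insert a F \<subseteq> carrier R" using insert.prems P.Icarr by blast
    have "b \<otimes> c \<otimes> s = \<zero>" if "s \<in> insert a F" for s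
    proof (cases "s = a")
      case True
      then show ?thesis using b c F by (simp add: m_assoc)
    next
      case False
      then have "c \<otimes> (b \<otimes> s) = \<zero>" using that b c by (simp add: ann_def)
      then show ?thesis using that b c F by (auto simp: m_ac subset_iff)
    qed
    then show ?case using b c P.I_prime by (intro bexI[of _ "b \<otimes> c"]) (auto simp: ann_def)
  qed
  then show ?thesis using that by blast
qed

lemma regular_notin_minimal_prime:
  assumes "P \<in> minimal_primes R" "r \<in> regular_elements R"
  shows "r \<notin> P"
proof
  assume "r \<in> P"
  then obtain b where b: "b \<in> carrier R" "b \<notin> P" "b \<otimes> r = \<zero>"
    using minimal_prime_killed assms(1) by blast
  then have "b = \<zero>" using regular_zeroD assms(2) by blast
  moreover interpret P: primeideal P R using assms(1) by (rule minimal_prime_is_prime)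
  have "\<zero> \<in> P" by (rule P.zero_closed)
  ultimately show False using b by simp
qed

lemma ann_eq_zero_if_no_minimal_prime:
  assumes S: "S \<subseteq> carrier R" "\<And>P. P \<in> minimal_primes R \<Longrightarrow> \<not> S \<subseteq> P" and y: "y \<in> ann R S"
  shows "y = \<zero>"
proof (rule ccontr)
  assume "y \<noteq> \<zero>"
  moreover have yc: "y \<in> carrier R" using y by (simp add: ann_def)
  ultimately obtain P where P: "P \<in> minimal_primes R" "y \<notin> P"
    using minimal_prime_not_containing by blast
  interpret P: primeideal P R using P by (blast dest: minimal_prime_is_prime)
  have "s \<in> P" if "s \<in> S" for s
  proof -
    have "y \<otimes> s = \<zero>" using y that by (simp add: ann_def)
    then have "y \<otimes> s \<in> P" using P.zero_closed by simp
    then show ?thesis using P.I_prime yc that S(1) P(2) by blast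
  qed
  then show False using S(2)[OF P(1)] by blast
qed

end

section \<open>Compactness in terms of ring elements\<close>

context cring
begin

text \<open>The sets \<open>D(a)\<close> with \<open>a \<in> A\<close> cover the space exactly if no minimal prime contains \<open>A\<close>, and
  every open cover is refined by the cover with all basic sets that lie in one of its members.\<close>

lemma compact_minimal_prime_space_iff:
  "compact_space (minimal_prime_space R) \<longleftrightarrow>
    (\<forall>A \<subseteq> carrier R. (\<forall>P \<in> minimal_primes R. \<not> A \<subseteq> P) \<longrightarrow>
      (\<exists>F. finite F \<and> F \<subseteq> A \<and> (\<forall>P \<in> minimal_primes R. \<not> F \<subseteq> P)))"
    (is "_ \<longleftrightarrow> ?fin")
proof (intro iffI allI impI)
  fix A assume comp: "compact_space (minimal_prime_space R)"
    and A: "A \<subseteq> carrier R" "\<forall>P \<in> minimal_primes R. \<not> A \<subseteq> P"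
  have subcover: "\<exists>\<F>. finite \<F> \<and> \<F> \<subseteq> \<U> \<and> minimal_primes R \<subseteq> \<Union>\<F>"
    if "\<forall>U \<in> \<U>. openin (minimal_prime_space R) U" "minimal_primes R \<subseteq> \<Union>\<U>" for \<U>
    using comp that by (simp add: compact_space_alt topspace_minimal_prime_space)
  have "\<exists>\<F>. finite \<F> \<and> \<F> \<subseteq> basic_open R ` A \<and> minimal_primes R \<subseteq> \<Union>\<F>"
  proof (rule subcover)
    show "\<forall>U \<in> basic_open R ` A. openin (minimal_prime_space R) U"
      proof
      fix U assume "U \<in> basic_open R ` A"
      then have "\<exists>a \<in> carrier R. U = basic_open R a" using A(1) by blast
      then show "openin (minimal_prime_space R) U"
        unfolding openin_minimal_prime_space by (intro union_of_inc) (simp_all add: arbitrary_def)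
    qed
    show "minimal_primes R \<subseteq> \<Union>(basic_open R ` A)" using A(2) by (auto simp: basic_open_def)
  qed
  then obtain F where F: "finite F" "F \<subseteq> A" "minimal_primes R \<subseteq> \<Union>(basic_open R ` F)"
    by (metis finite_subset_image)
  then have "\<not> F \<subseteq> P" if "P \<in> minimal_primes R" for P
    using that by (force simp: basic_open_def)
  with F show "\<exists>F. finite F \<and> F \<subseteq> A \<and> (\<forall>P \<in> minimal_primes R. \<not> F \<subseteq> P)" by blast
next
  assume fin: ?fin
  show "compact_space (minimal_prime_space R)"
    unfolding compact_space_alt topspace_minimal_prime_space
  proof (intro allI impI, elim conjE)
    fix \<U> assume op: "\<forall>U \<in> \<U>. openin (minimal_prime_space R) U"
      and cov: "minimal_primes R \<subseteq> \<Union>\<U>"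
    let ?A = "{a \<in> carrier R. \<exists>U \<in> \<U>. basic_open R a \<subseteq> U}"
    have A: "?A \<subseteq> carrier R" by blast
    have dense: "\<forall>P \<in> minimal_primes R. \<not> ?A \<subseteq> P"
    proof
      fix P assume P: "P \<in> minimal_primes R"
      obtain U where U: "U \<in> \<U>" "P \<in> U" using cov P by blast
      then have "(arbitrary union_of (\<lambda>U. \<exists>a \<in> carrier R. U = basic_open R a)) U"
        using op by (simp add: openin_minimal_prime_space)
      then obtain \<B> where \<B>: "\<B> \<subseteq> Collect (\<lambda>U. \<exists>a \<in> carrier R. U = basic_open R a)" "\<Union>\<B> = U"
        unfolding union_of_def by (elim exE conjE) (rule that)
      obtain B where B: "B \<in> \<B>" "P \<in> B" using U(2) \<B>(2) by blast
      then obtain a where a: "a \<in> carrier R" "B = basic_open R a" using \<B>(1) by blast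
      have "a \<in> ?A" using a B(1) \<B>(2) U(1) by auto
      moreover have "a \<notin> P" using a(2) B(2) by (simp add: basic_open_def)
      ultimately show "\<not> ?A \<subseteq> P" by blast
    qed
    obtain F where F: "finite F" "F \<subseteq> ?A" "\<forall>P \<in> minimal_primes R. \<not> F \<subseteq> P"
      using fin[THEN spec, THEN mp, THEN mp, OF A dense] by (elim exE conjE) (rule that)
    have "\<forall>a \<in> F. \<exists>U. U \<in> \<U> \<and> basic_open R a \<subseteq> U" using F(2) by blast
    then obtain g where g: "\<forall>a \<in> F. g a \<in> \<U> \<and> basic_open R a \<subseteq> g a" by (rule bchoice[THEN exE])
    have "minimal_primes R \<subseteq> \<Union>(g ` F)"
    proof
      fix P assume P: "P \<in> minimal_primes R"
      then obtain a where "a \<in> F" "a \<notin> P" using F(3) by blast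
      then show "P \<in> \<Union>(g ` F)" using g P by (auto simp: basic_open_def)
    qed
    then show "\<exists>\<F>. finite \<F> \<and> \<F> \<subseteq> \<U> \<and> minimal_primes R \<subseteq> \<Union>\<F>"
      using F(1) g by (intro exI[of _ "g ` F"]) auto
  qed
qed

lemma ideal_ann:
  assumes y: "y \<in> carrier R"
  shows "ideal (ann R {y}) R"
proof (rule idealI)
  show "subgroup (ann R {y}) (add_monoid R)"
  proof (rule group.subgroupI)
    show "group (add_monoid R)" by (rule a_group)
    show "ann R {y} \<noteq> {}" using y by (auto simp: ann_def intro!: exI[of _ \<zero>])
    show "\<And>x. x \<in> ann R {y} \<Longrightarrow> inv\<^bsub>add_monoid R\<^esub> x \<in> ann R {y}"
      using y by (auto simp: ann_def a_inv_def[symmetric] l_minus)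
    show "\<And>x z. \<lbrakk>x \<in> ann R {y}; z \<in> ann R {y}\<rbrakk> \<Longrightarrow> x \<otimes>\<^bsub>add_monoid R\<^esub> z \<in> ann R {y}"
      using y by (auto simp: ann_def l_distr)
  qed (auto simp: ann_def)
  fix a x assume a: "a \<in> ann R {y}" and x: "x \<in> carrier R"
  then show xa: "x \<otimes> a \<in> ann R {y}" using y by (auto simp: ann_def m_assoc)
  then show "a \<otimes> x \<in> ann R {y}" using a x by (simp add: ann_def m_comm)
qed (rule ring_axioms)

lemma ann_genideal:
  assumes S: "S \<subseteq> carrier R"
  shows "ann R (Idl S) = ann R S"
proof
  show "ann R (Idl S) \<subseteq> ann R S" using genideal_self[OF S] by (auto simp: ann_def)
  show "ann R S \<subseteq> ann R (Idl S)"
  proof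
    fix y assume y: "y \<in> ann R S"
    then have yc: "y \<in> carrier R" by (simp add: ann_def)
    have "S \<subseteq> ann R {y}" using y S by (auto simp: ann_def m_comm[of _ y])
    then have "Idl S \<subseteq> ann R {y}" using ideal_ann[OF yc] by (intro genideal_minimal)
    then show "y \<in> ann R (Idl S)" using yc by (auto simp: ann_def m_comm[of y])
  qed
qed

text \<open>The ideals generated by the finite subsets of \<open>S\<close> are directed by inclusion, so their union
  is an ideal.\<close>

lemma genideal_finite_support:
  assumes S: "S \<subseteq> carrier R" and r: "r \<in> Idl S"
  obtains F where "finite F" "F \<subseteq> S" "r \<in> Idl F"
proof -
  let ?J = "{x. \<exists>F. finite F \<and> F \<subseteq> S \<and> x \<in> Idl F}"
  have idl: "ideal (Idl F) R" if "F \<subseteq> S" for F using that S by (intro genideal_ideal) auto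
  have mono: "Idl F \<subseteq> Idl G" if "F \<subseteq> G" "G \<subseteq> S" for F G
    using that genideal_self[of G] S by (intro genideal_minimal idl) auto
  have "ideal ?J R"
  proof (rule idealI)
    show "subgroup ?J (add_monoid R)"
    proof (rule group.subgroupI)
      show "group (add_monoid R)" by (rule a_group)
      show "?J \<subseteq> carrier (add_monoid R)" using ideal.Icarr[OF idl] by auto
      have "\<zero> \<in> Idl {}" using additive_subgroup.zero_closed[OF ideal.axioms(1)[OF idl[of "{}"]]] by simp
      then show "?J \<noteq> {}" by blast
      fix x assume "x \<in> ?J"
      then show "inv\<^bsub>add_monoid R\<^esub> x \<in> ?J"
        using additive_subgroup.a_inv_closed[OF ideal.axioms(1)[OF idl]]
        unfolding a_inv_def[symmetric] by blast
    next
      fix x y assume "x \<in> ?J" "y \<in> ?J"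
      then obtain F G where F: "finite F" "F \<subseteq> S" "x \<in> Idl F" and G: "finite G" "G \<subseteq> S" "y \<in> Idl G"
        by blast
      then have FG: "F \<union> G \<subseteq> S" by blast
      have "x \<in> Idl (F \<union> G)" "y \<in> Idl (F \<union> G)" using mono[OF _ FG] F G by blast+
      then have "x \<oplus> y \<in> Idl (F \<union> G)"
        using additive_subgroup.a_closed[OF ideal.axioms(1)[OF idl[OF FG]]] by blast
      then show "x \<otimes>\<^bsub>add_monoid R\<^esub> y \<in> ?J" using F G FG by auto
    qed
    show "\<And>a x. \<lbrakk>a \<in> ?J; x \<in> carrier R\<rbrakk> \<Longrightarrow> x \<otimes> a \<in> ?J" using ideal.I_l_closed[OF idl] by blast
    show "\<And>a x. \<lbrakk>a \<in> ?J; x \<in> carrier R\<rbrakk> \<Longrightarrow> a \<otimes> x \<in> ?J" using ideal.I_r_closed[OF idl] by blast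
  qed (rule ring_axioms)
  moreover have "S \<subseteq> ?J"
  proof
    fix s assume "s \<in> S"
    then show "s \<in> ?J" using S genideal_self'[of s] by (intro CollectI exI[of _ "{s}"]) auto
  qed
  ultimately have "Idl S \<subseteq> ?J" by (rule genideal_minimal)
  then show ?thesis using r that by blast
qed

end

section \<open>Strongly dense ideals\<close>

context reduced_cring
begin

text \<open>The complements of the elements of \<open>I\<close> form a multiplicative set: if \<open>b\<close>, \<open>b'\<close> are complements of
  \<open>a\<close>, \<open>a'\<close>, expanding \<open>(a + b) (a' + b')\<close> shows that \<open>b b'\<close> is a complement of
  \<open>a a' + a b' + a' b\<close>, which lies in \<open>I\<close> again.  It avoids \<open>0\<close>, since \<open>0\<close> is a complement of
  regular elements only.  A minimal prime disjoint from it contains each \<open>a \<in> I\<close>, because it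
  contains \<open>a b = 0\<close> but not \<open>b\<close>.\<close>

lemma no_sd_ideal_if_complements:
  assumes compl: "\<forall>a \<in> carrier R. \<exists>b. complement R a b"
  shows "\<not> sd_ideal R I"
proof
  assume "sd_ideal R I"
  then have I: "ideal I R" "I \<subseteq> zero_divisors R"
    and no: "\<And>P. P \<in> minimal_primes R \<Longrightarrow> \<not> I \<subseteq> P"
    by (auto simp: sd_ideal_def)
  interpret I: ideal I R by (rule I(1))
  let ?S = "{b. \<exists>a \<in> I. complement R a b}"
  have "submonoid ?S R"
  proof
    show "?S \<subseteq> carrier R" by (auto simp: complement_def)
    show "\<one> \<in> ?S"
      using I.zero_closed regular_one by (auto simp: complement_def intro!: bexI[of _ \<zero>])
    fix b b' assume "b \<in> ?S" "b' \<in> ?S"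
    then obtain a a' where a: "a \<in> I" "a' \<in> I" and ab: "complement R a b" "complement R a' b'" by blast
    then have ab: "a \<otimes> b = \<zero>" "a' \<otimes> b' = \<zero>"
        "a \<oplus> b \<in> regular_elements R" "a' \<oplus> b' \<in> regular_elements R"
      and c: "a \<in> carrier R" "a' \<in> carrier R" "b \<in> carrier R" "b' \<in> carrier R"
      by (auto simp: complement_def)
    let ?a = "a \<otimes> a' \<oplus> a \<otimes> b' \<oplus> a' \<otimes> b"
    have "?a \<in> I" using a c by (intro I.a_closed I.I_r_closed)
    moreover have "?a \<otimes> (b \<otimes> b')
        = a \<otimes> b \<otimes> (a' \<otimes> b') \<oplus> a \<otimes> b \<otimes> (b' \<otimes> b') \<oplus> a' \<otimes> b' \<otimes> (b \<otimes> b)"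
      using c by algebra
    then have "?a \<otimes> (b \<otimes> b') = \<zero>" using c by (simp add: ab)
    moreover have "?a \<oplus> b \<otimes> b' = (a \<oplus> b) \<otimes> (a' \<oplus> b')" using c by algebra
    then have "?a \<oplus> b \<otimes> b' \<in> regular_elements R" using regular_mult[OF ab(3,4)] by simp
    ultimately show "b \<otimes> b' \<in> ?S" using c by (auto simp: complement_def)
  qed
  moreover have "\<zero> \<notin> ?S"
  proof
    assume "\<zero> \<in> ?S"
    then obtain a where "a \<in> I" "a \<oplus> \<zero> \<in> regular_elements R" by (auto simp: complement_def)
    then show False using I(2) I.Icarr by (auto simp: regular_elements_def)
  qed
  ultimately obtain P where P: "P \<in> minimal_primes R" "P \<inter> ?S = {}"
    by (rule minimal_prime_disjoint_submonoid)
  interpret P: primeideal P R using P by (blast dest: minimal_prime_is_prime)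
  have "I \<subseteq> P"
  proof
    fix a assume a: "a \<in> I"
    then obtain b where b: "complement R a b" using compl I.Icarr by blast
    then have "b \<notin> P" using P(2) a by blast
    moreover have "a \<otimes> b \<in> P" using b P.zero_closed by (simp add: complement_def)
    ultimately show "a \<in> P" using P.I_prime[of a b] I.Icarr[OF a] b by (auto simp: complement_def)
  qed
  then show False using no P(1) by blast
qed

lemma regular_in_ideal_if_no_sd_ideal:
  assumes "\<not> (\<exists>I. sd_ideal R I)" "ideal I R" "\<And>P. P \<in> minimal_primes R \<Longrightarrow> \<not> I \<subseteq> P"
  obtains r where "r \<in> I" "r \<in> regular_elements R"
proof -
  have "\<not> I \<subseteq> zero_divisors R" using assms by (auto simp: sd_ideal_def)
  then show ?thesis using that ideal.Icarr[OF assms(2)] by (auto simp: regular_elements_def)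
qed

lemma self_and_ann_no_minimal_prime:
  assumes "P \<in> minimal_primes R"
  shows "\<not> insert a (ann R {a}) \<subseteq> P"
proof
  assume sub: "insert a (ann R {a}) \<subseteq> P"
  then obtain b where "b \<in> carrier R" "b \<notin> P" "b \<otimes> a = \<zero>"
    using minimal_prime_killed assms by blast
  then show False using sub by (auto simp: ann_def)
qed

text \<open>The ideal \<open>a R + ann(a)\<close> lies in no minimal prime, so it contains a regular element
  \<open>r = x a + b\<close> with \<open>a b = 0\<close>.  Whatever kills both \<open>a\<close> and \<open>b\<close> kills \<open>r\<close>, hence is \<open>0\<close>.\<close>

lemma complement_if_no_sd_ideal:
  assumes no: "\<not> (\<exists>I. sd_ideal R I)" and a: "a \<in> carrier R"
  shows "\<exists>b. complement R a b"
proof -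
  interpret A: ideal "ann R {a}" R by (rule ideal_ann[OF a])
  let ?I = "PIdl a <+>\<^bsub>R\<^esub> ann R {a}"
  have I: "ideal ?I R" by (intro add_ideals cgenideal_ideal a A.ideal_axioms)
  have aI: "a \<oplus> \<zero> \<in> ?I"
    unfolding set_add_def' using cgenideal_self[OF a] A.zero_closed by blast
  have "\<zero> \<in> PIdl a"
    using additive_subgroup.zero_closed[OF ideal.axioms(1)[OF cgenideal_ideal[OF a]]] .
  then have "\<zero> \<oplus> b \<in> ?I" if "b \<in> ann R {a}" for b
    unfolding set_add_def' using that by blast
  then have "insert a (ann R {a}) \<subseteq> ?I" using aI a A.Icarr by auto
  then have "\<not> ?I \<subseteq> P" if "P \<in> minimal_primes R" for P
    using self_and_ann_no_minimal_prime[OF that] by blast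
  then obtain r where r: "r \<in> ?I" "r \<in> regular_elements R"
    using regular_in_ideal_if_no_sd_ideal[OF no I] by blast
  then obtain x b where x: "x \<in> carrier R" "b \<in> carrier R" "b \<otimes> a = \<zero>"
    "r = x \<otimes> a \<oplus> b"
    unfolding ann_def set_add_def' cgenideal_def by blast
  have "complement R a b"
  proof (rule complementI)
    show "a \<otimes> b = \<zero>" using x a by (simp add: m_comm)
    fix y assume y: "y \<in> carrier R" "y \<otimes> a = \<zero>" "y \<otimes> b = \<zero>"
    have "y \<otimes> r = y \<otimes> a \<otimes> x \<oplus> y \<otimes> b" using x(1,2) a y(1) unfolding x(4) by algebra
    then have "y \<otimes> r = \<zero>" using x by (simp add: y)
    then show "y = \<zero>" using regular_zeroD r(2) y(1) by blast
  qed (use a x in simp_all)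
  then show ?thesis ..
qed

text \<open>With complements, annihilators of finite sets are annihilators of single elements: the
  summands of \<open>a + b c\<close> are orthogonal, so only \<open>y b c = 0\<close> has to be improved to \<open>y c = 0\<close>, and this holds
  since \<open>y c\<close> is killed by the regular element \<open>a + b\<close>.\<close>

lemma ann_insert_complement:
  assumes b: "complement R a b" and c: "a \<in> carrier R" "c \<in> carrier R"
  shows "ann R {a, c} = ann R {a \<oplus> b \<otimes> c}"
proof -
  have b: "b \<in> carrier R" "a \<otimes> b = \<zero>" "a \<oplus> b \<in> regular_elements R"
    using b by (auto simp: complement_def)
  have "y \<otimes> a = \<zero> \<and> y \<otimes> c = \<zero>" if y: "y \<in> carrier R" "y \<otimes> (a \<oplus> b \<otimes> c) = \<zero>" for y
  proof -
    have "a \<otimes> (b \<otimes> c) = \<zero>" using b c by (simp add: m_assoc[symmetric])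
    then have ya: "y \<otimes> a = \<zero>" and ybc: "y \<otimes> (b \<otimes> c) = \<zero>"
      using mult_orthogonal_sum_eq_zeroD[of a "b \<otimes> c" y] y b(1) c by auto
    have "(y \<otimes> c) \<otimes> (a \<oplus> b) = y \<otimes> a \<otimes> c \<oplus> y \<otimes> (b \<otimes> c)" using b(1) c y(1) by algebra
    then have "(y \<otimes> c) \<otimes> (a \<oplus> b) = \<zero>" using c by (simp add: ya ybc)
    then show ?thesis using regular_zeroD[OF b(3)] c y(1) ya by simp
  qed
  moreover have "y \<otimes> (a \<oplus> b \<otimes> c) = \<zero>" if "y \<in> carrier R" "y \<otimes> a = \<zero>" "y \<otimes> c = \<zero>" for y
  proof -
    have "y \<otimes> (a \<oplus> b \<otimes> c) = y \<otimes> a \<oplus> y \<otimes> c \<otimes> b" using that(1) b(1) c by algebra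
    then show ?thesis using b(1) by (simp add: that)
  qed
  ultimately show ?thesis by (auto simp: ann_def)
qed

lemma property_ac_if_complements:
  assumes compl: "\<forall>a \<in> carrier R. \<exists>b. complement R a b"
  shows "property_ac R"
proof -
  have "\<exists>c \<in> carrier R. ann R F = ann R {c}" if "finite F" "F \<subseteq> carrier R" for F
    using that
  proof induction
    case empty
    have "ann R {} = ann R {\<zero>}" by (auto simp: ann_def)
    then show ?case by blast
  next
    case (insert a F)
    then obtain c where c: "c \<in> carrier R" "ann R F = ann R {c}" by auto
    obtain b where b: "complement R a b" using compl insert.prems by blast
    have "ann R (insert a F) = ann R {a} \<inter> ann R F" by (auto simp: ann_def)
    also have "\<dots> = ann R {a, c}" unfolding c(2) by (auto simp: ann_def)
    also have "\<dots> = ann R {a \<oplus> b \<otimes> c}"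
      using ann_insert_complement[OF b] insert.prems c by simp
    finally show ?case using b c insert.prems by (auto simp: complement_def)
  qed
  then show ?thesis by (auto simp: property_ac_def finitely_generated_ideal_def ann_genideal)
qed

lemma compact_if_no_sd_ideal:
  assumes no: "\<not> (\<exists>I. sd_ideal R I)"
  shows "compact_space (minimal_prime_space R)"
  unfolding compact_minimal_prime_space_iff
proof (intro allI impI)
  fix A assume A: "A \<subseteq> carrier R" "\<forall>P \<in> minimal_primes R. \<not> A \<subseteq> P"
  then have "\<not> Idl A \<subseteq> P" if "P \<in> minimal_primes R" for P
    using that genideal_self[OF A(1)] by blast
  then obtain r where r: "r \<in> Idl A" "r \<in> regular_elements R"
    using regular_in_ideal_if_no_sd_ideal[OF no genideal_ideal[OF A(1)]] by blast
  then obtain F where F: "finite F" "F \<subseteq> A" "r \<in> Idl F"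
    using genideal_finite_support[OF A(1)] by blast
  have "\<not> F \<subseteq> P" if P: "P \<in> minimal_primes R" for P
  proof
    assume "F \<subseteq> P"
    then have "Idl F \<subseteq> P"
      using P by (intro genideal_minimal) (auto simp: minimal_primes_def primeideal_def)
    then show False using regular_notin_minimal_prime[OF P r(2)] F(3) by blast
  qed
  with F show "\<exists>F. finite F \<and> F \<subseteq> A \<and> (\<forall>P \<in> minimal_primes R. \<not> F \<subseteq> P)" by blast
qed

lemma property_A_if_no_sd_ideal:
  assumes no: "\<not> (\<exists>I. sd_ideal R I)"
  shows "property_A R"
  unfolding property_A_def
proof (intro allI impI, elim conjE)
  fix I assume "finitely_generated_ideal R I" and zd: "I \<subseteq> zero_divisors R"
  then obtain F where F: "finite F" "F \<subseteq> carrier R" "I = Idl F"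
    by (auto simp: finitely_generated_ideal_def)
  then obtain P where P: "P \<in> minimal_primes R" "I \<subseteq> P"
    using no zd genideal_ideal by (auto simp: sd_ideal_def)
  have "F \<subseteq> P" using genideal_self[OF F(2)] F(3) P(2) by blast
  then obtain b where b: "b \<in> carrier R" "b \<notin> P" "b \<in> ann R F"
    using minimal_prime_finite_killed P(1) F(1) by blast
  interpret P: primeideal P R using P by (blast dest: minimal_prime_is_prime)
  have "b \<noteq> \<zero>" using b(2) P.zero_closed by auto
  then show "ann R I \<noteq> {\<zero>}" using b(3) F by (auto simp: ann_genideal)
qed

lemma no_sd_ideal_if_property_A_compact:
  assumes A: "property_A R" and comp: "compact_space (minimal_prime_space R)"
  shows "\<not> sd_ideal R I"
proof
  assume "sd_ideal R I"
  then have I: "ideal I R" "I \<subseteq> zero_divisors R" "\<forall>P \<in> minimal_primes R. \<not> I \<subseteq> P"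
    by (auto simp: sd_ideal_def)
  have Ic: "I \<subseteq> carrier R" using ideal.Icarr[OF I(1)] by blast
  then obtain F where F: "finite F" "F \<subseteq> I" "\<forall>P \<in> minimal_primes R. \<not> F \<subseteq> P"
    using comp I(3) unfolding compact_minimal_prime_space_iff by meson
  have Fc: "F \<subseteq> carrier R" using F(2) Ic by blast
  have "Idl F \<subseteq> zero_divisors R" using genideal_minimal[OF I(1) F(2)] I(2) by blast
  then have "ann R F \<noteq> {\<zero>}"
    using A F(1) Fc by (auto simp: property_A_def finitely_generated_ideal_def ann_genideal)
  moreover have "\<zero> \<in> ann R F" using Fc by (auto simp: ann_def)
  ultimately show False using ann_eq_zero_if_no_minimal_prime[OF Fc] F(3) by blast
qed

text \<open>Compactness gives finitely many elements of \<open>ann(a)\<close> that, together with \<open>a\<close>, lie in no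
  minimal prime and so have no common annihilator but \<open>0\<close>.  A single \<open>c\<close> with the same annihilator
  as those elements is orthogonal to \<open>a\<close>, since \<open>a\<close> kills all of them.\<close>

lemma complement_if_property_ac_compact:
  assumes ac: "property_ac R" and comp: "compact_space (minimal_prime_space R)"
    and a: "a \<in> carrier R"
  shows "\<exists>b. complement R a b"
proof -
  let ?S = "insert a (ann R {a})"
  have S: "?S \<subseteq> carrier R" using a by (auto simp: ann_def)
  obtain F where F: "finite F" "F \<subseteq> ?S" "\<forall>P \<in> minimal_primes R. \<not> F \<subseteq> P"
    using comp S self_and_ann_no_minimal_prime unfolding compact_minimal_prime_space_iff by meson
  let ?B = "F - {a}"
  have B: "?B \<subseteq> carrier R" "?B \<subseteq> ann R {a}" using F(2) S by auto
  then obtain c where c: "c \<in> carrier R" "ann R ?B = ann R {c}"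
    using ac F(1) ann_genideal[OF B(1)] unfolding property_ac_def finitely_generated_ideal_def
    by (metis finite_Diff)
  have "complement R a c"
  proof (rule complementI)
    have "a \<in> ann R ?B" using a B by (auto simp: ann_def m_comm)
    then show "a \<otimes> c = \<zero>" unfolding c(2) by (simp add: ann_def)
    fix y assume y: "y \<in> carrier R" "y \<otimes> a = \<zero>" "y \<otimes> c = \<zero>"
    then have "y \<in> ann R ?B" unfolding c(2) by (simp add: ann_def)
    then have "y \<in> ann R F" using y by (auto simp: ann_def)
    then show "y = \<zero>"
      using ann_eq_zero_if_no_minimal_prime[of F y] F S by blast
  qed (use a c in simp_all)
  then show ?thesis ..
qed

end

theorem theorem2p9:
  fixes R :: "('a, 'm) ring_scheme"
  assumes "cring R" and "reduced_ring R"
  shows "(von_neumann_regular (total_quotient_ring R)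
            \<longleftrightarrow> property_A R \<and> compact_space (minimal_prime_space R))
       \<and> (property_A R \<and> compact_space (minimal_prime_space R)
            \<longleftrightarrow> \<not> (\<exists>I. sd_ideal R I))
       \<and> (\<not> (\<exists>I. sd_ideal R I)
            \<longleftrightarrow> property_ac R \<and> compact_space (minimal_prime_space R))"
proof -
  interpret reduced_cring R using assms by (simp add: reduced_cring_def reduced_cring_axioms_def)
  have "(\<forall>a \<in> carrier R. \<exists>b. complement R a b) \<longleftrightarrow> \<not> (\<exists>I. sd_ideal R I)"
    using no_sd_ideal_if_complements complement_if_no_sd_ideal by blast
  then show ?thesis
    using von_neumann_regular_iff_complement no_sd_ideal_if_property_A_compact
      property_A_if_no_sd_ideal compact_if_no_sd_ideal property_ac_if_complements
      complement_if_property_ac_compact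
    by blast
qed

end
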